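(* Let $\omega\in(0,\tfrac18)$, let $P^0$ satisfy the smallness hypotheses (H) stated in the context, let $P^{k+1}=S_{\mathrm H}(P^k)$ for $k\ge0$, and let $X,Y\in C^1(\mathbb{R})$ be the limits of the horizontal coordinates $x^k,y^k$. Then $F_i^k=2^kR_i^k$ converges uniformly under the dyadic parametrisation $t=i\,2^{-k}$ to $$f(t)=\tfrac14\bigl(X(t)Y'(t)-Y(t)X'(t)\bigr),$$ i.e. $\sup_{i\in\mathbb{Z}}|F_i^k-f(i2^{-k})|\to0$ as $k\to\infty$, and this expression for the limit (in particular the coefficient $\tfrac14$) is the same for every $\omega\in(0,\tfrac18)$. In particular $\sup_i|F_i^k|\to\|f\|_\infty$, which is nonzero unless the horizontal limit curve $t\mapsto(X(t),Y(t))$ lies on a single line through the origin (constant polar angle modulo $\pi$).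
   Context: For a real sequence $u=\{u_i\}_{i\in\mathbb{Z}}$ the four-point operator $L_4$ with parameter $\omega$ is $(L_4u)_{2i}=u_i$, $(L_4u)_{2i+1}=-\omega u_{i-1}+(\tfrac12+\omega)u_i+(\tfrac12+\omega)u_{i+1}-\omega u_{i+2}$. The Heisenberg four-point subdivision operator $S_{\mathrm H}$ maps $P^k=\{(x_i^k,y_i^k,z_i^k)\}_{i\in\mathbb{Z}}\subset\mathbb{R}^3$ to $P^{k+1}$ defined by $P^{k+1}_{2i}=P^k_i$ and $P^{k+1}_{2i+1}=(X_{2i+1},Y_{2i+1},Z_{2i+1})$ with $X_{2i+1}=(L_4x^k)_{2i+1}$, $Y_{2i+1}=(L_4y^k)_{2i+1}$, $Z_{2i+1}=(L_4z^k)_{2i+1}+R_i^k$, where $R_i^k=\tfrac12(x_i^kb_i^k-y_i^ka_i^k)$, $a_i^k=X_{2i+1}-x_i^k$, $b_i^k=Y_{2i+1}-y_i^k$. Notation: $\|\Delta_hP\|_\infty=\sup_i(|x_{i+1}-x_i|+|y_{i+1}-y_i|)$ and $\|\Delta_h^2P\|_\infty=\sup_i(|x_{i+1}-2x_i+x_{i-1}|+|y_{i+1}-2y_i+y_{i-1}|)$. Hypotheses (H): $\sup_i\|P_i^0\|\le C$, $\|\Delta_hP^0\|_\infty\le\varepsilon_0$, $\|\Delta_h^2P^0\|_\infty\le\varepsilon_0$, for a fixed constant $C$ and a sufficiently small $\varepsilon_0>0$ depending only on $\omega$ (that is, there exists such an $\varepsilon_0$ for which the result holds). Dyadic parametrisation: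 the level-$k$ node with index $i$ is assigned the parameter value $t=i2^{-k}$. $X$ and $Y$ are the uniform-on-compacts limits of the piecewise-linear interpolants of $x^k$ and $y^k$ at the nodes $i2^{-k}$; they are the classical four-point limits and are $C^1$.
   Formalization: The last clause (f nonzero unless the curve lies on a line through the origin) is false if the horizontal curve rests at the origin and leaves along another line; it is stated for each parameter interval on which (X,Y) and (X',Y') never vanish simultaneously. *)

theory Defs
  imports "HOL-Analysis.Analysis"
begin

text \<open>The four-point operator.  On \<^typ>\<open>int\<close>, \<open>div\<close> rounds down, so an odd \<open>j\<close> is
  \<open>2 * i + 1\<close> with \<open>i = j div 2\<close> also for negative \<open>j\<close>.\<close>

definition L4 :: "real \<Rightarrow> (int \<Rightarrow> real) \<Rightarrow> int \<Rightarrow> real" where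
  "L4 \<omega> u j = (let i = j div 2 in
     if even j then u i
     else - \<omega> * u (i - 1) + (1/2 + \<omega>) * u i + (1/2 + \<omega>) * u (i + 1) - \<omega> * u (i + 2))"

lemma L4_even: "L4 \<omega> u (2 * i) = u i"
  by (simp add: L4_def)

lemma L4_odd: "L4 \<omega> u (2 * i + 1) =
    - \<omega> * u (i - 1) + (1/2 + \<omega>) * u i + (1/2 + \<omega>) * u (i + 1) - \<omega> * u (i + 2)"
  by (simp add: L4_def)

type_synonym polygon = "int \<Rightarrow> real \<times> real \<times> real"

definition xc :: "polygon \<Rightarrow> int \<Rightarrow> real" where "xc P i = fst (P i)"
definition yc :: "polygon \<Rightarrow> int \<Rightarrow> real" where "yc P i = fst (snd (P i))"
definition zc :: "polygon \<Rightarrow> int \<Rightarrow> real" where "zc P i = snd (snd (P i))"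

definition heis_R :: "real \<Rightarrow> polygon \<Rightarrow> int \<Rightarrow> real" where
  "heis_R \<omega> P i =
    (let a = L4 \<omega> (xc P) (2 * i + 1) - xc P i;
         b = L4 \<omega> (yc P) (2 * i + 1) - yc P i
     in 1/2 * (xc P i * b - yc P i * a))"

definition S_H :: "real \<Rightarrow> polygon \<Rightarrow> polygon" where
  "S_H \<omega> P j =
    (if even j then P (j div 2)
     else (L4 \<omega> (xc P) j, L4 \<omega> (yc P) j, L4 \<omega> (zc P) j + heis_R \<omega> P (j div 2)))"

lemma S_H_even: "S_H \<omega> P (2 * i) = P i"
  by (simp add: S_H_def)

lemma S_H_odd: "S_H \<omega> P (2 * i + 1) =
    (L4 \<omega> (xc P) (2 * i + 1), L4 \<omega> (yc P) (2 * i + 1),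
     L4 \<omega> (zc P) (2 * i + 1) + heis_R \<omega> P i)"
  by (simp add: S_H_def)

definition heis_iter :: "real \<Rightarrow> polygon \<Rightarrow> nat \<Rightarrow> polygon" where
  "heis_iter \<omega> P0 k = (S_H \<omega> ^^ k) P0"

text \<open>Suprema are taken in the extended reals, so that they are meaningful
  (namely \<open>\<infinity>\<close>) also for unbounded families.\<close>

definition sup_norm :: "('i \<Rightarrow> real) \<Rightarrow> ereal" where
  "sup_norm g = (SUP i. ereal \<bar>g i\<bar>)"

definition Delta_h_norm :: "polygon \<Rightarrow> ereal" where
  "Delta_h_norm P =
    sup_norm (\<lambda>i. \<bar>xc P (i + 1) - xc P i\<bar> + \<bar>yc P (i + 1) - yc P i\<bar>)"

definition Delta2_h_norm :: "polygon \<Rightarrow> ereal" where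
  "Delta2_h_norm P =
    sup_norm (\<lambda>i. \<bar>xc P (i + 1) - 2 * xc P i + xc P (i - 1)\<bar>
               + \<bar>yc P (i + 1) - 2 * yc P i + yc P (i - 1)\<bar>)"

text \<open>The norm on \<^typ>\<open>real \<times> real \<times> real\<close> is the Euclidean one.\<close>

definition hyp_H :: "real \<Rightarrow> real \<Rightarrow> polygon \<Rightarrow> bool" where
  "hyp_H C \<epsilon> P \<longleftrightarrow>
     sup_norm (\<lambda>i. norm (P i)) \<le> ereal C \<and> Delta_h_norm P \<le> ereal \<epsilon> \<and> Delta2_h_norm P \<le> ereal \<epsilon>"

text \<open>The piecewise-linear function with value \<open>u i\<close> at the node \<open>i * 2 powr - k\<close>.\<close>

definition pl_interp :: "nat \<Rightarrow> (int \<Rightarrow> real) \<Rightarrow> real \<Rightarrow> real" where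
  "pl_interp k u t =
    (let s = 2 ^ k * t; i = \<lfloor>s\<rfloor> in (1 - frac s) * u i + frac s * u (i + 1))"

definition dyadic_limit :: "(nat \<Rightarrow> int \<Rightarrow> real) \<Rightarrow> (real \<Rightarrow> real) \<Rightarrow> bool" where
  "dyadic_limit u U \<longleftrightarrow>
     (\<forall>K. compact K \<longrightarrow> uniform_limit K (\<lambda>k. pl_interp k (u k)) U sequentially)"

definition heis_F :: "real \<Rightarrow> polygon \<Rightarrow> nat \<Rightarrow> int \<Rightarrow> real" where
  "heis_F \<omega> P0 k i = 2 ^ k * heis_R \<omega> (heis_iter \<omega> P0 k) i"

text \<open>The expression for the limit; it does not involve \<open>\<omega>\<close>.\<close>

definition heis_f :: "(real \<Rightarrow> real) \<Rightarrow> (real \<Rightarrow> real) \<Rightarrow> real \<Rightarrow> real" where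
  "heis_f X Y t = 1/4 * (X t * deriv Y t - Y t * deriv X t)"

text \<open>The polar angle modulo \<open>\<pi>\<close> of a \<open>C\<^sup>1\<close> curve makes sense along a set \<open>J\<close> of
  parameters if the curve never comes to rest at the origin: at a passage
  through the origin with nonzero velocity it is the direction of the velocity.  If the
  curve does rest at the origin, it may leave along a different line although
  \<open>heis_f X Y\<close> vanishes identically.\<close>

definition polar_angle_defined :: "(real \<Rightarrow> real) \<Rightarrow> (real \<Rightarrow> real) \<Rightarrow> real set \<Rightarrow> bool" where
  "polar_angle_defined X Y J \<longleftrightarrow>
     (\<forall>t\<in>J. (X t, Y t) \<noteq> (0, 0) \<or> (deriv X t, deriv Y t) \<noteq> (0, 0))"

definition on_line_through_origin :: "(real \<Rightarrow> real) \<Rightarrow> (real \<Rightarrow> real) \<Rightarrow> real set \<Rightarrow> bool" where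
  "on_line_through_origin X Y J \<longleftrightarrow>
     (\<exists>v::real \<times> real. v \<noteq> 0 \<and> (\<forall>t\<in>J. (X t, Y t) \<in> span {v}))"

end

theory Submission
  imports Defs
begin

text \<open>
  Since \<open>P\<^sup>k\<^sup>+\<^sup>1\<close> keeps the old nodes, the increments \<open>a\<close> and \<open>b\<close> in the vertical correction
  are first differences of the next level, between the nodes \<open>2 * i\<close> and \<open>2 * i + 1\<close>.
  With \<open>slope u k i = 2\<^sup>k (u k (i + 1) - u k i)\<close> this reads
    \<open>F = 1/4 * (x * slope y (k + 1) (2 * i) - y * slope x (k + 1) (2 * i))\<close>
  (lemma \<open>heis_F_slopes\<close>): one factor \<open>1/2\<close> is that of the correction, the other one
  comes from comparing \<open>2\<^sup>k\<close> with the mesh \<open>2\<^sup>-\<^sup>k\<^sup>-\<^sup>1\<close> of the increments.  The parameter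
  \<open>\<omega>\<close> has disappeared, and the convergence is reduced to the statement that slopes
  converge uniformly to the derivative of the limit.

  For one coordinate this is the classical smoothness analysis of the four-point scheme.
  The jumps of the slopes between neighbouring nodes obey a linear
  recursion of their own.  It does not contract the supremum norm in one step, but it contracts
  a norm that gives jumps at even and odd indices different weights
  (lemma \<open>jump_contraction\<close>), with a factor less than one precisely because \<open>\<omega> < 1/8\<close>.
  Refinement changes a slope by at most the bound on the jumps, so slopes above a fixed dyadic node
  form a Cauchy sequence with a geometric rate independent of the node
  (lemma \<open>slope_nested\<close>).  The scheme interpolates, hence these slopes
  are difference quotients of the limit function at the node, and their limit is its
  derivative (lemma \<open>slope_approximates_deriv\<close>).

  Convergence of the suprema follows because the nodes become dense and the limit is
  continuous (lemma \<open>sup_norm_sampling\<close>).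

  If the limit vanishes, \<open>(X, Y)\<close> and its derivative are everywhere parallel.  Where
  the curve is away from the origin its direction is then stationary.  A passage through the
  origin with nonzero velocity happens at an isolated parameter, and the direction extends
  continuously across it, so it is constant on an interval
  (lemma \<open>zero_areal_velocity_imp_line\<close>).
\<close>

section \<open>Divided differences of the four-point scheme\<close>

definition slope :: "(nat \<Rightarrow> int \<Rightarrow> real) \<Rightarrow> nat \<Rightarrow> int \<Rightarrow> real" where
  "slope u k i = 2 ^ k * (u k (i + 1) - u k i)"

lemma int_parity_cases:
  fixes j :: int
  obtains i where "j = 2 * i" | i where "j = 2 * i + 1"
  by (metis evenE oddE)

lemma pl_interp_node: "pl_interp k v (of_int i / 2 ^ k) = v i"
  by (simp add: pl_interp_def)

lemma nested_node: "(of_int i :: real) / 2 ^ k = of_int (2 ^ m * i) / 2 ^ (k + m)"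
  by (simp add: power_add)

text \<open>The levels of one coordinate.  All constants below depend on \<open>\<omega>\<close> and \<open>M\<close> only, so
  two coordinates with a common bound share them.\<close>

locale four_point_scheme =
  fixes \<omega> :: real and u :: "nat \<Rightarrow> int \<Rightarrow> real" and M :: real
  assumes omega_pos: "0 < \<omega>" and omega_less: "\<omega> < 1/8"
    and step: "\<And>k. u (Suc k) = L4 \<omega> (u k)"
    and bounded_start: "\<And>i. \<bar>u 0 i\<bar> \<le> M"
begin

definition jump :: "nat \<Rightarrow> int \<Rightarrow> real" where
  "jump k i = slope u k (i + 1) - slope u k i"

lemma M_nonneg: "0 \<le> M"
  using bounded_start[of 0] by linarith

lemma step_even: "u (Suc k) (2 * i) = u k i"
  by (simp add: step L4_even)

lemma step_odd: "u (Suc k) (2 * i + 1) =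
    - \<omega> * u k (i - 1) + (1/2 + \<omega>) * u k i + (1/2 + \<omega>) * u k (i + 1) - \<omega> * u k (i + 2)"
  by (simp add: step L4_odd)

lemma slope_even: "slope u (Suc k) (2 * i) = slope u k i + 2 * \<omega> * (slope u k (i - 1) - slope u k (i + 1))"
  unfolding slope_def step_odd step_even power_Suc by (simp add: algebra_simps)

lemma slope_odd: "slope u (Suc k) (2 * i + 1) = slope u k i - 2 * \<omega> * (slope u k (i - 1) - slope u k (i + 1))"
proof -
  have "slope u (Suc k) (2 * i + 1) = 2 ^ Suc k * (u (Suc k) (2 * (i + 1)) - u (Suc k) (2 * i + 1))"
    by (simp add: slope_def algebra_simps)
  then show ?thesis
    unfolding step_odd step_even by (simp add: slope_def algebra_simps)
qed

lemma jump_even: "jump (Suc k) (2 * i) = 4 * \<omega> * (jump k (i - 1) + jump k i)"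
  unfolding jump_def slope_odd slope_even by (simp add: algebra_simps)

lemma jump_odd: "jump (Suc k) (2 * i + 1) =
    (1 - 4 * \<omega>) * jump k i - 2 * \<omega> * (jump k (i - 1) + jump k (i + 1))"
proof -
  have "jump (Suc k) (2 * i + 1) = slope u (Suc k) (2 * (i + 1)) - slope u (Suc k) (2 * i + 1)"
    by (simp add: jump_def algebra_simps)
  then show ?thesis
    unfolding slope_even slope_odd by (simp add: jump_def algebra_simps)
qed

text \<open>A new jump at an odd index contains \<open>1 - 4 * \<omega>\<close> times an old jump and \<open>- 2 * \<omega>\<close> times
  two neighbours, so its bound in the supremum norm is only \<open>(1 - 4 * \<omega>) + 4 * \<omega> = 1\<close>.
  One of these two groups sits at even indices.  If jumps at even indices are known to be
  smaller by a factor \<open>\<alpha> < 1\<close>, the bound drops below \<open>1\<close>; the recursion at even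
  indices preserves the factor if \<open>4 * \<omega> * (1 + \<alpha>) < \<alpha>\<close>.  The value
  \<open>\<alpha> = 1/2 + 4 * \<omega>\<close> satisfies both conditions exactly when
  \<open>\<omega> < 1/8\<close> for positive \<open>\<omega>\<close>.\<close>

definition even_weight :: real where "even_weight = 1/2 + 4 * \<omega>"

definition weight :: "int \<Rightarrow> real" where "weight i = (if even i then even_weight else 1)"

text \<open>The contraction factors of the even recursion, and of the odd one when its
  central index is even or odd, respectively.\<close>

definition rate :: real where
  "rate = max (4 * \<omega> * (1 + even_weight) / even_weight)
     (max ((1 - 4 * \<omega>) * even_weight + 4 * \<omega>) (1 - 4 * \<omega> + 4 * \<omega> * even_weight))"

lemma even_weight_bounds: "0 < even_weight" "even_weight < 1"
  using omega_pos omega_less by (auto simp: even_weight_def)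

lemma rate_pos: "0 < rate"
  using omega_pos even_weight_bounds by (auto simp: rate_def less_max_iff_disj)

lemma rate_less_1: "rate < 1"
proof -
  have "\<omega> * \<omega> < 1/8 * (1/8)"
    using omega_pos omega_less by (intro mult_strict_mono) auto
  then have "4 * \<omega> * (1 + even_weight) < even_weight"
    using omega_less by (simp add: even_weight_def algebra_simps)
  moreover have "(1 - 4 * \<omega>) * even_weight < (1 - 4 * \<omega>) * 1"
    using even_weight_bounds omega_less by (intro mult_strict_left_mono) auto
  moreover have "4 * \<omega> * even_weight < 4 * \<omega> * 1"
    using even_weight_bounds omega_pos by (intro mult_strict_left_mono) auto
  ultimately show ?thesis
    using even_weight_bounds(1) by (simp add: rate_def)
qed

lemma rate_bounds:
  "4 * \<omega> * (1 + even_weight) \<le> rate * even_weight"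
  "(1 - 4 * \<omega>) * even_weight + 4 * \<omega> \<le> rate"
  "1 - 4 * \<omega> + 4 * \<omega> * even_weight \<le> rate"
proof -
  have "4 * \<omega> * (1 + even_weight) / even_weight \<le> rate"
    by (simp add: rate_def)
  then show "4 * \<omega> * (1 + even_weight) \<le> rate * even_weight"
    using even_weight_bounds(1) by (simp add: pos_divide_le_eq)
qed (simp_all add: rate_def)

lemma jump_contraction:
  assumes B: "0 \<le> B" and k: "\<And>i. \<bar>jump k i\<bar> \<le> weight i * B"
  shows "\<bar>jump (Suc k) j\<bar> \<le> weight j * (rate * B)"
proof (cases j rule: int_parity_cases)
  case (1 i)
  have "weight (i - 1) + weight i = 1 + even_weight"
    by (simp add: weight_def)
  then have "\<bar>jump k (i - 1) + jump k i\<bar> \<le> (1 + even_weight) * B"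
    using k[of "i - 1"] k[of i] by (smt (verit) distrib_right)
  then have "\<bar>jump (Suc k) j\<bar> \<le> 4 * \<omega> * ((1 + even_weight) * B)"
    using omega_pos by (simp add: 1 jump_even abs_mult)
  also have "\<dots> \<le> rate * even_weight * B"
    using mult_right_mono[OF rate_bounds(1) B] by (simp add: mult.assoc)
  finally show ?thesis
    by (simp add: 1 weight_def algebra_simps)
next
  case (2 i)
  have "\<bar>jump (Suc k) j\<bar> \<le> \<bar>(1 - 4 * \<omega>) * jump k i\<bar> + \<bar>2 * \<omega> * (jump k (i - 1) + jump k (i + 1))\<bar>"
    unfolding 2 jump_odd by (rule abs_triangle_ineq4)
  also have "\<dots> = (1 - 4 * \<omega>) * \<bar>jump k i\<bar> + 2 * \<omega> * \<bar>jump k (i - 1) + jump k (i + 1)\<bar>"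
    using omega_pos omega_less by (simp add: abs_mult)
  also have "\<dots> \<le> (1 - 4 * \<omega>) * (weight i * B) + 2 * \<omega> * (weight (i - 1) * B + weight (i + 1) * B)"
    using omega_pos omega_less k[of i] k[of "i - 1"] k[of "i + 1"]
    by (intro add_mono mult_left_mono) (auto intro: order_trans[OF abs_triangle_ineq])
  also have "\<dots> = ((1 - 4 * \<omega>) * weight i + 4 * \<omega> * weight (i + 1)) * B"
    by (simp add: weight_def algebra_simps)
  also have "\<dots> \<le> rate * B"
    using rate_bounds(2,3) B by (intro mult_right_mono) (auto simp: weight_def)
  finally show ?thesis
    by (simp add: 2 weight_def)
qed

definition jump_const :: real where "jump_const = 4 * M / even_weight"

lemma jump_const_nonneg: "0 \<le> jump_const"
  using M_nonneg even_weight_bounds by (simp add: jump_const_def)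

lemma jump_weighted_bound: "\<bar>jump k i\<bar> \<le> weight i * (jump_const * rate ^ k)"
proof (induction k arbitrary: i)
  case 0
  have "\<bar>jump 0 i\<bar> \<le> 4 * M"
    using bounded_start[of i] bounded_start[of "i + 1"] bounded_start[of "i + 1 + 1"]
    by (simp add: jump_def slope_def)
  also have "\<dots> \<le> weight i * jump_const"
    using M_nonneg even_weight_bounds by (auto simp: weight_def jump_const_def field_simps
      intro: mult_right_le_one_le)
  finally show ?case by simp
next
  case (Suc k)
  show ?case
    using jump_contraction[OF _ Suc] jump_const_nonneg rate_pos by (simp add: algebra_simps)
qed

lemma jump_bound: "\<bar>jump k i\<bar> \<le> jump_const * rate ^ k"
proof -
  have "weight i * (jump_const * rate ^ k) \<le> 1 * (jump_const * rate ^ k)"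
    using even_weight_bounds jump_const_nonneg rate_pos
    by (intro mult_right_mono) (auto simp: weight_def)
  then show ?thesis
    using jump_weighted_bound[of k i] by simp
qed

text \<open>A new slope differs from the old one over the same interval by \<open>2 * \<omega>\<close> times the sum of
  two jumps.\<close>

lemma slope_refine: "\<bar>slope u (Suc k) j - slope u k (j div 2)\<bar> \<le> jump_const * rate ^ k"
proof -
  have *: "\<bar>2 * \<omega> * (slope u k (i - 1) - slope u k (i + 1))\<bar> \<le> jump_const * rate ^ k" for i
  proof -
    have "\<bar>slope u k (i - 1) - slope u k (i + 1)\<bar> \<le> 2 * (jump_const * rate ^ k)"
      using jump_bound[of k "i - 1"] jump_bound[of k i] by (simp add: jump_def)
    then have "\<bar>2 * \<omega> * (slope u k (i - 1) - slope u k (i + 1))\<bar>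
        \<le> 2 * (1/8) * (2 * (jump_const * rate ^ k))"
      unfolding abs_mult using omega_pos omega_less by (intro mult_mono) auto
    also have "\<dots> \<le> jump_const * rate ^ k"
      using jump_const_nonneg rate_pos by simp
    finally show ?thesis .
  qed
  show ?thesis
    by (cases j rule: int_parity_cases)
       (use * in \<open>auto simp: slope_even slope_odd abs_minus_commute\<close>)
qed

text \<open>The sum of \<open>jump_const * rate ^ l\<close> over \<open>l \<ge> k\<close>, so that telescoping needs only
  \<open>tail_Suc\<close>.\<close>

definition tail :: "nat \<Rightarrow> real" where "tail k = jump_const * rate ^ k / (1 - rate)"

lemma tail_nonneg: "0 \<le> tail k"
  using jump_const_nonneg rate_pos rate_less_1 by (simp add: tail_def)

lemma tail_Suc: "tail k = jump_const * rate ^ k + tail (Suc k)"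
  using rate_less_1 by (simp add: tail_def field_simps)

lemma tail_tendsto_0: "tail \<longlonglongrightarrow> 0"
proof -
  have "(\<lambda>k. jump_const * rate ^ k / (1 - rate)) \<longlonglongrightarrow> jump_const * 0 / (1 - rate)"
    using rate_pos rate_less_1 by (intro tendsto_intros LIMSEQ_power_zero) auto
  then show ?thesis
    unfolding tail_def[abs_def] by simp
qed

text \<open>The index \<open>2 ^ m * i\<close> at level \<open>k + m\<close> names the node \<open>i\<close> of level \<open>k\<close>, so this is a
  uniform Cauchy estimate for the right-hand slopes at a fixed dyadic point.\<close>

lemma slope_nested: "\<bar>slope u (k + m) (2 ^ m * i) - slope u k i\<bar> \<le> tail k - tail (k + m)"
proof (induction m)
  case (Suc m)
  have "\<bar>slope u (k + Suc m) (2 ^ Suc m * i) - slope u (k + m) (2 ^ m * i)\<bar> \<le> jump_const * rate ^ (k + m)"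
    using slope_refine[of "k + m" "2 ^ Suc m * i"] by (simp add: mult.assoc)
  then show ?case
    using Suc tail_Suc[of "k + m"] by simp
qed simp

lemma slope_bound: "\<bar>slope u k i\<bar> \<le> 2 * M + tail 0"
proof -
  have "\<bar>slope u k i\<bar> \<le> 2 * M + tail 0 - tail k"
  proof (induction k arbitrary: i)
    case 0
    show ?case
      using bounded_start[of i] bounded_start[of "i + 1"] by (simp add: slope_def)
  next
    case (Suc k)
    show ?case
      using Suc[of "i div 2"] slope_refine[of k i] tail_Suc[of k] by simp
  qed
  then show ?thesis
    using tail_nonneg[of k] by (smt (verit))
qed

text \<open>Each inserted value differs from its left neighbour by a slope divided by
  \<open>2 ^ Suc k\<close>, and these corrections sum to at most one slope bound.\<close>

lemma value_bound: "\<bar>u k i\<bar> \<le> 3 * M + tail 0"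
proof -
  have "\<bar>u k i\<bar> \<le> M + (2 * M + tail 0) * (1 - 1 / 2 ^ k)"
  proof (induction k arbitrary: i)
    case 0
    show ?case using bounded_start by simp
  next
    case (Suc k)
    show ?case
    proof (cases i rule: int_parity_cases)
      case (1 j)
      have "(2 * M + tail 0) * (1 - 1 / 2 ^ k) \<le> (2 * M + tail 0) * (1 - 1 / 2 ^ Suc k)"
        using M_nonneg tail_nonneg[of 0] by (intro mult_left_mono) (auto simp: field_simps)
      then show ?thesis
        using Suc[of j] by (simp add: 1 step_even)
    next
      case (2 j)
      have "u (Suc k) i = u k j + slope u (Suc k) (2 * j) / 2 ^ Suc k"
        by (simp add: 2 slope_def step_even)
      moreover have "\<bar>slope u (Suc k) (2 * j) / 2 ^ Suc k\<bar> \<le> (2 * M + tail 0) / 2 ^ Suc k"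
        using slope_bound[of "Suc k" "2 * j"] by (simp add: divide_right_mono)
      ultimately have "\<bar>u (Suc k) i\<bar> \<le> M + (2 * M + tail 0) * (1 - 1 / 2 ^ k) + (2 * M + tail 0) / 2 ^ Suc k"
        using Suc[of j] by linarith
      moreover have "(2 * M + tail 0) * (1 - 1 / 2 ^ k) + (2 * M + tail 0) / 2 ^ Suc k
          = (2 * M + tail 0) * (1 - 1 / 2 ^ Suc k)"
        by (simp add: field_simps)
      ultimately show ?thesis
        by linarith
    qed
  qed
  also have "\<dots> \<le> M + (2 * M + tail 0) * 1"
    using M_nonneg tail_nonneg[of 0] by (intro add_left_mono mult_left_mono) auto
  finally show ?thesis by simp
qed

section \<open>Nodal values and derivatives of the limit\<close>

lemma nested_value: "u (k + m) (2 ^ m * i) = u k i"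
proof (induction m)
  case (Suc m)
  have "u (k + Suc m) (2 ^ Suc m * i) = u (Suc (k + m)) (2 * (2 ^ m * i))"
    by (simp add: mult.assoc)
  then show ?case
    using Suc by (simp only: step_even)
qed simp

lemma limit_at_node:
  assumes "dyadic_limit u U"
  shows "U (of_int i / 2 ^ k) = u k i"
proof -
  let ?t = "of_int i / 2 ^ k :: real"
  have "uniform_limit {?t} (\<lambda>n. pl_interp n (u n)) U sequentially"
    using assms compact_sing unfolding dyadic_limit_def by blast
  then have "(\<lambda>n. pl_interp n (u n) ?t) \<longlonglongrightarrow> U ?t"
    by (rule tendsto_uniform_limitI) simp
  then have "(\<lambda>m. pl_interp (m + k) (u (m + k)) ?t) \<longlonglongrightarrow> U ?t"
    by (rule LIMSEQ_ignore_initial_segment)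
  moreover have "pl_interp (m + k) (u (m + k)) ?t = u k i" for m
    unfolding nested_node[of i k m] add.commute[of m k]
    by (simp only: pl_interp_node nested_value)
  ultimately show ?thesis
    by (simp add: LIMSEQ_const_iff)
qed

text \<open>The slope at level \<open>k + m\<close> is the difference quotient of the limit function with step
  \<open>1 / 2 ^ (k + m)\<close>, because the limit passes through all nodal values.  Letting
  \<open>m\<close> tend to infinity in the Cauchy estimate replaces the fine slope by the derivative.\<close>

lemma slope_approximates_deriv:
  assumes lim: "dyadic_limit u U"
    and deriv: "(U has_real_derivative D) (at (of_int i / 2 ^ k))"
  shows "\<bar>D - slope u k i\<bar> \<le> tail k"
proof -
  let ?t = "of_int i / 2 ^ k :: real"
  have quot: "(U (?t + 1 / 2 ^ (k + m)) - U ?t) / (1 / 2 ^ (k + m)) = slope u (k + m) (2 ^ m * i)" for m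
  proof -
    have "?t + 1 / 2 ^ (k + m) = of_int (2 ^ m * i + 1) / 2 ^ (k + m)"
      by (simp add: nested_node[of i k m] add_divide_distrib)
    then have "U (?t + 1 / 2 ^ (k + m)) = u (k + m) (2 ^ m * i + 1)"
      by (simp only: limit_at_node[OF lim])
    moreover have "U ?t = u (k + m) (2 ^ m * i)"
      by (simp only: limit_at_node[OF lim] nested_value)
    ultimately show ?thesis
      by (simp add: slope_def)
  qed
  have "((\<lambda>h. (U (?t + h) - U ?t) / h) \<longlongrightarrow> D) (at 0)"
    using deriv by (simp add: DERIV_def)
  moreover have "filterlim (\<lambda>m. 1 / 2 ^ (k + m) :: real) (at 0) sequentially"
  proof -
    have "(\<lambda>m. (1/2) ^ (m + k) :: real) \<longlonglongrightarrow> 0"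
      by (rule LIMSEQ_ignore_initial_segment, rule LIMSEQ_power_zero) simp
    then show ?thesis
      by (simp add: filterlim_at power_one_over add.commute)
  qed
  ultimately have "(\<lambda>m. slope u (k + m) (2 ^ m * i)) \<longlonglongrightarrow> D"
    unfolding quot[symmetric] by (rule filterlim_compose)
  then have "(\<lambda>m. \<bar>slope u (k + m) (2 ^ m * i) - slope u k i\<bar>) \<longlonglongrightarrow> \<bar>D - slope u k i\<bar>"
    by (intro tendsto_intros)
  then show ?thesis
    by (rule LIMSEQ_le_const2) (use slope_nested tail_nonneg in \<open>smt (verit)\<close>)
qed

end

section \<open>Supremum norms\<close>

lemma sup_norm_le_iff: "sup_norm g \<le> ereal c \<longleftrightarrow> (\<forall>i. \<bar>g i\<bar> \<le> c)"
  by (simp add: sup_norm_def SUP_le_iff)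

lemma le_sup_norm: "ereal \<bar>g i\<bar> \<le> sup_norm g"
  unfolding sup_norm_def by (rule SUP_upper) simp

lemma sup_norm_nonneg: "0 \<le> sup_norm g"
  using le_sup_norm[of g undefined] by (rule order_trans[rotated]) simp

lemma sup_norm_tendsto_0:
  assumes "\<And>k i. \<bar>g k i\<bar> \<le> c k" and "c \<longlonglongrightarrow> 0"
  shows "(\<lambda>k. sup_norm (g k)) \<longlonglongrightarrow> 0"
proof (rule tendsto_sandwich[OF _ _ tendsto_const])
  show "(\<lambda>k. ereal (c k)) \<longlonglongrightarrow> 0"
    using assms(2) by (simp add: zero_ereal_def)
qed (use assms(1) in \<open>auto simp: sup_norm_le_iff sup_norm_nonneg\<close>)

lemma dyadic_floor_tendsto: "(\<lambda>n. of_int \<lfloor>2 ^ n * t\<rfloor> / 2 ^ n) \<longlonglongrightarrow> (t::real)"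
proof (rule real_tendsto_sandwich)
  have "(\<lambda>n. t - (1/2) ^ n) \<longlonglongrightarrow> t - 0"
    by (intro tendsto_intros LIMSEQ_power_zero) simp
  then show "(\<lambda>n. t - (1/2) ^ n) \<longlonglongrightarrow> t"
    by simp
  show "\<forall>\<^sub>F n in sequentially. t - (1/2) ^ n \<le> of_int \<lfloor>2 ^ n * t\<rfloor> / 2 ^ n"
  proof (rule always_eventually, rule allI)
    fix n
    have "2 ^ n * t - 1 \<le> of_int \<lfloor>2 ^ n * t\<rfloor>"
      by linarith
    then have "(2 ^ n * t - 1) / 2 ^ n \<le> of_int \<lfloor>2 ^ n * t\<rfloor> / 2 ^ n"
      by (rule divide_right_mono) simp
    then show "t - (1/2) ^ n \<le> of_int \<lfloor>2 ^ n * t\<rfloor> / 2 ^ n"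
      by (simp add: diff_divide_distrib power_one_over)
  qed
  show "\<forall>\<^sub>F n in sequentially. of_int \<lfloor>2 ^ n * t\<rfloor> / 2 ^ n \<le> t"
    by (rule always_eventually) (simp add: field_simps mult.commute)
qed (rule tendsto_const)

text \<open>The lower bound is where continuity and density enter: a value of \<open>f\<close> above the level \<open>a\<close> is
  also attained up to a small error at a dyadic point, and that point is a node of all
  sufficiently fine levels.\<close>

lemma sup_norm_sampling:
  fixes f :: "real \<Rightarrow> real" and G :: "nat \<Rightarrow> int \<Rightarrow> real"
  assumes cont: "continuous_on UNIV f"
    and err: "(\<lambda>k. sup_norm (\<lambda>i. G k i - f (of_int i / 2 ^ k))) \<longlonglongrightarrow> 0"
  shows "(\<lambda>k. sup_norm (G k)) \<longlonglongrightarrow> sup_norm f"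
proof (rule order_tendstoI)
  define e where "e k = sup_norm (\<lambda>i. G k i - f (of_int i / 2 ^ k))" for k
  have shift: "(\<lambda>k. a + e k) \<longlonglongrightarrow> a" for a
    using tendsto_add_ereal_general1[of 0 "\<lambda>_. a" a sequentially e] err
    by (simp add: e_def[abs_def])
  {
    fix a assume "sup_norm f < a"
    then have "\<forall>\<^sub>F k in sequentially. sup_norm f + e k < a"
      by (intro order_tendstoD(2)[OF shift])
    moreover have "sup_norm (G k) \<le> sup_norm f + e k" for k
      unfolding sup_norm_def[of "G k"]
    proof (rule SUP_least)
      fix i
      let ?t = "of_int i / 2 ^ k :: real"
      have "ereal \<bar>G k i\<bar> \<le> ereal \<bar>f ?t\<bar> + ereal \<bar>G k i - f ?t\<bar>"
        by simp
      also have "\<dots> \<le> sup_norm f + e k"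
        unfolding e_def using le_sup_norm[of "\<lambda>i. G k i - f (of_int i / 2 ^ k)" i]
        by (intro add_mono le_sup_norm)
      finally show "ereal \<bar>G k i\<bar> \<le> sup_norm f + e k" .
    qed
    ultimately show "\<forall>\<^sub>F k in sequentially. sup_norm (G k) < a"
      by (blast intro: eventually_mono le_less_trans)
  next
    fix a assume "a < sup_norm f"
    then obtain t where t: "a < ereal \<bar>f t\<bar>"
      by (auto simp: sup_norm_def less_SUP_iff)
    have "(\<lambda>n. ereal \<bar>f (of_int \<lfloor>2 ^ n * t\<rfloor> / 2 ^ n)\<bar>) \<longlonglongrightarrow> ereal \<bar>f t\<bar>"
      using cont
      by (intro tendsto_intros lim_ereal[THEN iffD2] continuous_on_tendsto_compose[OF cont] dyadic_floor_tendsto) auto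
    from eventually_happens[OF order_tendstoD(1)[OF this t]] obtain n where
      n: "a < ereal \<bar>f (of_int \<lfloor>2 ^ n * t\<rfloor> / 2 ^ n)\<bar>"
      by auto
    define j where "j = \<lfloor>2 ^ n * t\<rfloor>"
    have "\<forall>\<^sub>F k in sequentially. a + e k < ereal \<bar>f (of_int j / 2 ^ n)\<bar>"
      using n unfolding j_def by (intro order_tendstoD(2)[OF shift])
    then show "\<forall>\<^sub>F k in sequentially. a < sup_norm (G k)"
      using eventually_ge_at_top[of n]
    proof eventually_elim
      case (elim k)
      let ?i = "2 ^ (k - n) * j"
      have "of_int j / 2 ^ n = (of_int ?i / 2 ^ k :: real)"
        using elim(2) by (simp add: field_simps flip: power_add)
      then have "ereal \<bar>f (of_int j / 2 ^ n)\<bar> \<le> ereal \<bar>G k ?i\<bar> + ereal \<bar>G k ?i - f (of_int ?i / 2 ^ k)\<bar>"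
        by simp
      also have "\<dots> \<le> sup_norm (G k) + e k"
        unfolding e_def using le_sup_norm[of "\<lambda>i. G k i - f (of_int i / 2 ^ k)" ?i]
        by (intro add_mono le_sup_norm)
      finally have "a + e k < sup_norm (G k) + e k"
        using elim(1) by simp
      then show ?case
        using add_right_mono[of "sup_norm (G k)" a "e k"] by (auto simp: not_le[symmetric])
    qed
  }
qed

section \<open>Curves with vanishing areal velocity\<close>

lemma C1_real_derivatives:
  fixes X :: "real \<Rightarrow> real"
  assumes "X C1_differentiable_on UNIV"
  shows "(X has_real_derivative deriv X t) (at t)" "continuous_on UNIV (deriv X)"
proof -
  obtain D where D: "\<And>t. (X has_vector_derivative D t) (at t)" and cont: "continuous_on UNIV D"
    using assms by (auto simp: C1_differentiable_on_def)
  then have D': "\<And>t. (X has_real_derivative D t) (at t)"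
    by (simp add: has_real_derivative_iff_has_vector_derivative)
  then have "deriv X = D"
    by (auto intro!: DERIV_imp_deriv)
  with D' cont show "(X has_real_derivative deriv X t) (at t)" "continuous_on UNIV (deriv X)"
    by auto
qed

lemma regular_zero_isolated:
  assumes "(X has_real_derivative D) (at t)" "X t = (0::real)" "D \<noteq> 0"
  shows "\<forall>\<^sub>F s in at t. X s \<noteq> 0"
proof -
  have "((\<lambda>s. (X s - X t) / (s - t)) \<longlongrightarrow> D) (at t)"
    using assms(1) by (simp add: has_field_derivative_iff)
  from tendsto_imp_eventually_ne[OF this assms(3)] show ?thesis
    by eventually_elim (use assms(2) in auto)
qed

lemma locally_constant_on_interval:
  fixes \<psi> :: "real \<Rightarrow> real"
  assumes J: "is_interval J" and st: "s \<in> J" "t \<in> J"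
    and loc: "\<And>r. r \<in> J \<Longrightarrow> \<exists>\<delta>>0. \<forall>r'\<in>ball r \<delta> \<inter> J. \<psi> r' = \<psi> r"
  shows "\<psi> s = \<psi> t"
proof -
  have "\<psi> constant_on J"
  proof (rule locally_constant_imp_constant)
    show "connected J"
      using J is_interval_connected by blast
    fix r assume "r \<in> J"
    then obtain \<delta> where "\<delta> > 0" "\<forall>r'\<in>ball r \<delta> \<inter> J. \<psi> r' = \<psi> r"
      using loc by blast
    moreover have "openin (top_of_set J) (J \<inter> ball r \<delta>)"
      by (rule openin_open_Int) simp
    ultimately show "\<exists>T. openin (top_of_set J) T \<and> r \<in> T \<and> (\<forall>x\<in>T. \<psi> x = \<psi> r)"
      using \<open>r \<in> J\<close> by (metis IntI Int_commute centre_in_ball)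
  qed
  then show ?thesis
    using st by (auto simp: constant_on_def)
qed

text \<open>Fix the direction \<open>(a, b)\<close> of the curve at a parameter \<open>t0\<close>.  The function \<open>\<psi>\<close> in the
  proof is, up to the factor \<open>a\<^sup>2 + b\<^sup>2\<close>, the squared sine of the angle between the curve
  and \<open>(a, b)\<close>.  Including the derivatives in numerator and denominator does not
  change this value away from the origin, since position and velocity are parallel, and it
  makes \<open>\<psi>\<close> continuous across the zeros of the curve.  Its derivative vanishes except at
  these isolated zeros, so \<open>\<psi>\<close> is constant, and it is zero at \<open>t0\<close>.\<close>

lemma zero_areal_velocity_imp_line:
  fixes X Y :: "real \<Rightarrow> real"
  assumes X: "X C1_differentiable_on UNIV" and Y: "Y C1_differentiable_on UNIV"
    and par: "\<And>t. X t * deriv Y t = Y t * deriv X t"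
    and J: "is_interval J" and pol: "polar_angle_defined X Y J"
  shows "on_line_through_origin X Y J"
proof (cases "J = {}")
  case True
  then show ?thesis
    by (auto simp: on_line_through_origin_def intro!: exI[of _ "(1, 0)"] simp: zero_prod_def)
next
  case False
  then obtain t0 where t0: "t0 \<in> J" by blast
  note dX = C1_real_derivatives[OF X] and dY = C1_real_derivatives[OF Y]
  have cX: "continuous_on A X" and cY: "continuous_on A Y" for A
    using dX(1) dY(1) by (meson DERIV_isCont continuous_at_imp_continuous_on)+
  have cX': "continuous_on A (deriv X)" and cY': "continuous_on A (deriv Y)" for A
    using dX(2) dY(2) continuous_on_subset by blast+
  obtain a b where ab: "(a, b) \<noteq> (0, 0)"
    and v: "a * Y t0 = b * X t0" "a * deriv Y t0 = b * deriv X t0"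
  proof (cases "(X t0, Y t0) = (0, 0)")
    case True
    with that[of "deriv X t0" "deriv Y t0"] pol t0 show ?thesis
      by (auto simp: polar_angle_defined_def mult.commute)
  next
    case False
    with that[of "X t0" "Y t0"] par[of t0] show ?thesis
      by (auto simp: mult.commute)
  qed
  define g where "g t = a * Y t - b * X t" for t
  define g' where "g' t = a * deriv Y t - b * deriv X t" for t
  define \<psi> where "\<psi> t = ((g t)\<^sup>2 + (g' t)\<^sup>2) /
    ((X t)\<^sup>2 + (Y t)\<^sup>2 + ((deriv X t)\<^sup>2 + (deriv Y t)\<^sup>2))" for t
  have den: "(X t)\<^sup>2 + (Y t)\<^sup>2 + ((deriv X t)\<^sup>2 + (deriv Y t)\<^sup>2) > 0" if "t \<in> J" for t
    using pol that unfolding polar_angle_defined_def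
    by (smt (verit, best) Pair_inject sum_power2_gt_zero_iff zero_le_power2)
  have cont: "continuous_on J \<psi>"
    unfolding \<psi>_def g_def g'_def using den
    by (intro continuous_intros cX cY cX' cY') force
  have eq: "\<psi> t = (g t)\<^sup>2 / ((X t)\<^sup>2 + (Y t)\<^sup>2)" if nz: "(X t)\<^sup>2 + (Y t)\<^sup>2 \<noteq> 0" for t
  proof -
    have pos: "(X t)\<^sup>2 + (Y t)\<^sup>2 + ((deriv X t)\<^sup>2 + (deriv Y t)\<^sup>2) > 0"
      using nz by (smt (verit) zero_le_power2)
    have "(g' t)\<^sup>2 * ((X t)\<^sup>2 + (Y t)\<^sup>2) = (g t)\<^sup>2 * ((deriv X t)\<^sup>2 + (deriv Y t)\<^sup>2)"
      unfolding g_def g'_def using par[of t] by algebra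
    then show ?thesis
      using nz pos unfolding \<psi>_def
      by (subst frac_eq_eq) (auto simp: algebra_simps)
  qed
  have deriv0: "(\<psi> has_real_derivative 0) (at t)" if nz: "(X t)\<^sup>2 + (Y t)\<^sup>2 \<noteq> 0" for t
  proof -
    have "continuous_on UNIV (\<lambda>s. (X s)\<^sup>2 + (Y s)\<^sup>2)"
      by (intro continuous_intros cX cY)
    then have "open {s. (X s)\<^sup>2 + (Y s)\<^sup>2 \<noteq> 0}"
      by (intro open_Collect_neq continuous_on_const)
    moreover have "((\<lambda>s. (g s)\<^sup>2 / ((X s)\<^sup>2 + (Y s)\<^sup>2)) has_real_derivative 0) (at t)"
      unfolding g_def
    proof (rule DERIV_cong)
      show "((\<lambda>s. (a * Y s - b * X s)\<^sup>2 / ((X s)\<^sup>2 + (Y s)\<^sup>2)) has_real_derivative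
          (2 * g t * g' t * ((X t)\<^sup>2 + (Y t)\<^sup>2) - (g t)\<^sup>2 * (2 * X t * deriv X t + 2 * Y t * deriv Y t))
            / (((X t)\<^sup>2 + (Y t)\<^sup>2) * ((X t)\<^sup>2 + (Y t)\<^sup>2))) (at t)"
        by (rule derivative_eq_intros dX(1) dY(1) refl nz)+
           (simp add: g_def g'_def algebra_simps)
      have "2 * g t * g' t * ((X t)\<^sup>2 + (Y t)\<^sup>2) - (g t)\<^sup>2 * (2 * X t * deriv X t + 2 * Y t * deriv Y t) = 0"
        unfolding g_def g'_def using par[of t] by algebra
      then show "(2 * g t * g' t * ((X t)\<^sup>2 + (Y t)\<^sup>2) - (g t)\<^sup>2 * (2 * X t * deriv X t + 2 * Y t * deriv Y t))
            / (((X t)\<^sup>2 + (Y t)\<^sup>2) * ((X t)\<^sup>2 + (Y t)\<^sup>2)) = 0"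
        by simp
    qed
    ultimately show ?thesis
      using has_field_derivative_transform_within_open[of _ 0 t _ \<psi>] nz eq by fastforce
  qed
  have "\<psi> t = 0" if "t \<in> J" for t
  proof -
    have "\<psi> t = \<psi> t0"
    proof (rule locally_constant_on_interval[OF J that t0])
      fix r assume r: "r \<in> J"
      \<comment> \<open>The curve avoids the origin near \<open>r\<close>, except possibly at \<open>r\<close> itself.\<close>
      have "\<forall>\<^sub>F s in at r. (X s)\<^sup>2 + (Y s)\<^sup>2 \<noteq> 0"
      proof (cases "(X r, Y r) = (0, 0)")
        case True
        with pol r have "deriv X r \<noteq> 0 \<or> deriv Y r \<noteq> 0"
          by (auto simp: polar_angle_defined_def)
        with True have "(\<forall>\<^sub>F s in at r. X s \<noteq> 0) \<or> (\<forall>\<^sub>F s in at r. Y s \<noteq> 0)"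
          using regular_zero_isolated[OF dX(1)[of r]] regular_zero_isolated[OF dY(1)[of r]] by auto
        then show ?thesis
          by (auto elim!: eventually_mono simp: sum_power2_eq_zero_iff)
      next
        case False
        have "((\<lambda>s. (X s)\<^sup>2 + (Y s)\<^sup>2) \<longlongrightarrow> (X r)\<^sup>2 + (Y r)\<^sup>2) (at r)"
          using cX[of UNIV] cY[of UNIV] by (intro tendsto_intros) (auto simp: continuous_on)
        then show ?thesis
          by (rule tendsto_imp_eventually_ne) (use False in \<open>auto simp: sum_power2_eq_zero_iff\<close>)
      qed
      then obtain \<delta> where \<delta>: "\<delta> > 0"
        "\<And>s. s \<noteq> r \<Longrightarrow> dist s r < \<delta> \<Longrightarrow> (X s)\<^sup>2 + (Y s)\<^sup>2 \<noteq> 0"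
        by (auto simp: eventually_at)
      have "\<psi> s = \<psi> r" if s: "s \<in> ball r \<delta> \<inter> J" for s
      proof (rule has_derivative_zero_unique_strong_convex[where S = "ball r \<delta> \<inter> J" and K = "{r}" and c = r and f = \<psi>])
        show "convex (ball r \<delta> \<inter> J)"
          using J by (intro convex_Int convex_ball) (simp add: is_interval_convex)
        show "continuous_on (ball r \<delta> \<inter> J) \<psi>"
          using cont by (rule continuous_on_subset) auto
        fix x assume "x \<in> ball r \<delta> \<inter> J - {r}"
        then have "(\<psi> has_real_derivative 0) (at x)"
          using \<delta>(2)[of x] by (intro deriv0) (auto simp: dist_commute)
        then have "(\<psi> has_derivative (\<lambda>h. 0)) (at x)"
          by (simp only: has_field_derivative_def lambda_zero)
        then show "(\<psi> has_derivative (\<lambda>h. 0)) (at x within ball r \<delta> \<inter> J)"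
          by (rule has_derivative_at_withinI)
      qed (use s r \<delta>(1) in auto)
      with \<delta>(1) show "\<exists>\<delta>>0. \<forall>r'\<in>ball r \<delta> \<inter> J. \<psi> r' = \<psi> r"
        by blast
    qed
    also have "\<psi> t0 = 0"
      using v by (simp add: \<psi>_def g_def g'_def)
    finally show ?thesis .
  qed
  then have g0: "a * Y t = b * X t" if "t \<in> J" for t
    using den[OF that] that by (force simp: \<psi>_def g_def sum_power2_eq_zero_iff)
  have "(X t, Y t) \<in> span {(a, b)}" if "t \<in> J" for t
  proof -
    have nz: "a\<^sup>2 + b\<^sup>2 \<noteq> 0"
      using ab by (auto simp: sum_power2_eq_zero_iff)
    have "X t * (a\<^sup>2 + b\<^sup>2) = (a * X t + b * Y t) * a" "Y t * (a\<^sup>2 + b\<^sup>2) = (a * X t + b * Y t) * b"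
      using g0[OF that] by algebra+
    then have "(X t, Y t) = ((a * X t + b * Y t) / (a\<^sup>2 + b\<^sup>2)) *\<^sub>R (a, b)"
      using nz by (simp add: field_simps)
    then show ?thesis
      by (metis span_base span_scale insertI1)
  qed
  with ab show ?thesis
    unfolding on_line_through_origin_def
    by (intro exI[of _ "(a, b)"]) (auto simp: zero_prod_def)
qed

section \<open>The vertical correction\<close>

lemma heis_iter_Suc: "heis_iter \<omega> P (Suc k) = S_H \<omega> (heis_iter \<omega> P k)"
  by (simp add: heis_iter_def)

lemma xc_S_H: "xc (S_H \<omega> P) = L4 \<omega> (xc P)"
  by (rule ext) (auto simp: xc_def S_H_def L4_def)

lemma yc_S_H: "yc (S_H \<omega> P) = L4 \<omega> (yc P)"
  by (rule ext) (auto simp: yc_def S_H_def L4_def)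

lemma abs_coord_le_norm: "\<bar>xc P i\<bar> \<le> norm (P i)" "\<bar>yc P i\<bar> \<le> norm (P i)"
proof -
  show "\<bar>xc P i\<bar> \<le> norm (P i)"
    unfolding xc_def using norm_fst_le[of "fst (P i)" "snd (P i)"] by simp
  have "\<bar>fst (snd (P i))\<bar> \<le> norm (snd (P i))"
    using norm_fst_le[of "fst (snd (P i))" "snd (snd (P i))"] by simp
  also have "\<dots> \<le> norm (P i)"
    using norm_snd_le[of "snd (P i)" "fst (P i)"] by simp
  finally show "\<bar>yc P i\<bar> \<le> norm (P i)"
    by (simp add: yc_def)
qed

text \<open>The increment from \<open>P\<^sub>i\<close> to the inserted point is a first difference at level
  \<open>Suc k\<close>, whose slope carries the factor \<open>2 ^ Suc k\<close>; hence the coefficient \<open>1/4\<close>.\<close>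

lemma heis_F_slopes:
  "heis_F \<omega> P k i = 1/4 *
     (xc (heis_iter \<omega> P k) i * slope (\<lambda>k. yc (heis_iter \<omega> P k)) (Suc k) (2 * i)
      - yc (heis_iter \<omega> P k) i * slope (\<lambda>k. xc (heis_iter \<omega> P k)) (Suc k) (2 * i))"
  unfolding heis_F_def heis_R_def slope_def heis_iter_Suc xc_S_H yc_S_H L4_even Let_def
  by (simp add: algebra_simps)

lemma quarter_difference_bound:
  fixes p q c :: real
  assumes "\<bar>p\<bar> \<le> c" "\<bar>q\<bar> \<le> c"
  shows "\<bar>1/4 * (p - q)\<bar> \<le> c"
proof -
  have "\<bar>p - q\<bar> \<le> 2 * c" and "0 \<le> c"
    using assms by linarith+
  then show ?thesis
    by (simp add: abs_mult)
qed

theorem lemma5p4: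
  fixes \<omega> :: real
  assumes "0 < \<omega>" and "\<omega> < 1/8"
  shows "\<exists>\<epsilon>0>0. \<forall>(C::real) (P0::polygon) (X::real \<Rightarrow> real) (Y::real \<Rightarrow> real).
    hyp_H C \<epsilon>0 P0 \<and>
    dyadic_limit (\<lambda>k. xc (heis_iter \<omega> P0 k)) X \<and> X C1_differentiable_on UNIV \<and>
    dyadic_limit (\<lambda>k. yc (heis_iter \<omega> P0 k)) Y \<and> Y C1_differentiable_on UNIV \<longrightarrow>
      (\<lambda>k. sup_norm (\<lambda>i::int. heis_F \<omega> P0 k i - heis_f X Y (of_int i / 2 ^ k))) \<longlonglongrightarrow> 0 \<and>
      sup_norm (heis_f X Y) < \<infinity> \<and>
      (\<lambda>k. sup_norm (heis_F \<omega> P0 k)) \<longlonglongrightarrow> sup_norm (heis_f X Y) \<and>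
      (\<forall>J. is_interval J \<and> polar_angle_defined X Y J \<longrightarrow>
         sup_norm (heis_f X Y) \<noteq> 0 \<or> on_line_through_origin X Y J)"
proof (intro exI[of _ "1::real"] conjI allI impI zero_less_one; elim conjE)
  fix C :: real and P0 :: polygon and X Y :: "real \<Rightarrow> real"
  define u where "u k = xc (heis_iter \<omega> P0 k)" for k
  define v where "v k = yc (heis_iter \<omega> P0 k)" for k
  assume H: "hyp_H C 1 P0"
    and limX: "dyadic_limit (\<lambda>k. xc (heis_iter \<omega> P0 k)) X"
    and C1X: "X C1_differentiable_on UNIV"
    and limY: "dyadic_limit (\<lambda>k. yc (heis_iter \<omega> P0 k)) Y"
    and C1Y: "Y C1_differentiable_on UNIV"
  have C: "norm (P0 i) \<le> C" for i
    using H by (simp add: hyp_H_def sup_norm_le_iff)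
  interpret x: four_point_scheme \<omega> u C
    by unfold_locales
       (use assms C order_trans[OF abs_coord_le_norm(1) C] in
         \<open>simp_all add: u_def heis_iter_Suc xc_S_H, simp add: heis_iter_def\<close>)
  interpret y: four_point_scheme \<omega> v C
    by unfold_locales
       (use assms C order_trans[OF abs_coord_le_norm(2) C] in
         \<open>simp_all add: v_def heis_iter_Suc yc_S_H, simp add: heis_iter_def\<close>)
  have limu: "dyadic_limit u X" and limv: "dyadic_limit v Y"
    using limX limY by (simp_all add: u_def[abs_def] v_def[abs_def])
  note dX = C1_real_derivatives[OF C1X] and dY = C1_real_derivatives[OF C1Y]
  have F: "heis_F \<omega> P0 k i = 1/4 * (u k i * slope v (Suc k) (2 * i) - v k i * slope u (Suc k) (2 * i))"
    for k i
    by (simp add: heis_F_slopes u_def[abs_def] v_def[abs_def])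
  \<comment> \<open>One bound for values and slopes of both coordinates.\<close>
  define K where "K = 3 * C + x.tail 0"
  have K: "\<bar>u k i\<bar> \<le> K" "\<bar>v k i\<bar> \<le> K" "\<bar>slope u k i\<bar> \<le> K" "\<bar>slope v k i\<bar> \<le> K" for k i
    using x.value_bound[of k i] y.value_bound[of k i] x.slope_bound[of k i] y.slope_bound[of k i]
      x.M_nonneg unfolding K_def by linarith+
  have K0: "0 \<le> K"
    using K(1)[of 0 0] by linarith
  have err: "\<bar>heis_F \<omega> P0 k i - heis_f X Y (of_int i / 2 ^ k)\<bar> \<le> K * x.tail (Suc k)" for k i
  proof -
    let ?t = "of_int i / 2 ^ k :: real"
    have t: "?t = of_int (2 * i) / 2 ^ Suc k"
      by simp
    have ex: "\<bar>deriv X ?t - slope u (Suc k) (2 * i)\<bar> \<le> x.tail (Suc k)"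
      unfolding t by (rule x.slope_approximates_deriv[OF limu dX(1)])
    have ey: "\<bar>deriv Y ?t - slope v (Suc k) (2 * i)\<bar> \<le> x.tail (Suc k)"
      unfolding t by (rule y.slope_approximates_deriv[OF limv dY(1)])
    have "heis_F \<omega> P0 k i - heis_f X Y ?t =
        1/4 * (v k i * (deriv X ?t - slope u (Suc k) (2 * i)) - u k i * (deriv Y ?t - slope v (Suc k) (2 * i)))"
      unfolding F heis_f_def x.limit_at_node[OF limu] y.limit_at_node[OF limv]
      by (simp add: algebra_simps)
    moreover have "\<bar>v k i * (deriv X ?t - slope u (Suc k) (2 * i))\<bar> \<le> K * x.tail (Suc k)"
      unfolding abs_mult using K(2)[of k i] ex K0 by (intro mult_mono) auto
    moreover have "\<bar>u k i * (deriv Y ?t - slope v (Suc k) (2 * i))\<bar> \<le> K * x.tail (Suc k)"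
      unfolding abs_mult using K(1)[of k i] ey K0 by (intro mult_mono) auto
    ultimately show ?thesis
      by (simp only: quarter_difference_bound)
  qed
  have "(\<lambda>k. K * x.tail (Suc k)) \<longlonglongrightarrow> K * 0"
    by (intro tendsto_intros LIMSEQ_Suc x.tail_tendsto_0)
  then show uniform: "(\<lambda>k. sup_norm (\<lambda>i. heis_F \<omega> P0 k i - heis_f X Y (of_int i / 2 ^ k))) \<longlonglongrightarrow> 0"
    using err by (intro sup_norm_tendsto_0[where c = "\<lambda>k. K * x.tail (Suc k)"]) auto
  have "continuous_on UNIV X" "continuous_on UNIV Y"
    using dX(1) dY(1) by (meson DERIV_isCont continuous_at_imp_continuous_on)+
  then have "continuous_on UNIV (heis_f X Y)"
    unfolding heis_f_def[abs_def] by (intro continuous_intros dX dY)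
  then show sups: "(\<lambda>k. sup_norm (heis_F \<omega> P0 k)) \<longlonglongrightarrow> sup_norm (heis_f X Y)"
    using uniform by (rule sup_norm_sampling)
  have "sup_norm (heis_F \<omega> P0 k) \<le> ereal (K * K)" for k
    unfolding sup_norm_le_iff
  proof
    fix i
    have "\<bar>u k i * slope v (Suc k) (2 * i)\<bar> \<le> K * K" "\<bar>v k i * slope u (Suc k) (2 * i)\<bar> \<le> K * K"
      unfolding abs_mult using K K0 by (intro mult_mono; simp)+
    then show "\<bar>heis_F \<omega> P0 k i\<bar> \<le> K * K"
      unfolding F by (rule quarter_difference_bound)
  qed
  then have "sup_norm (heis_f X Y) \<le> ereal (K * K)"
    by (intro LIMSEQ_le_const2[OF sups]) auto
  then show "sup_norm (heis_f X Y) < \<infinity>"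
    by (rule le_less_trans) simp
  fix J assume J: "is_interval J" and pol: "polar_angle_defined X Y J"
  show "sup_norm (heis_f X Y) \<noteq> 0 \<or> on_line_through_origin X Y J"
  proof (cases "sup_norm (heis_f X Y) = 0")
    case True
    then have "sup_norm (heis_f X Y) \<le> ereal 0"
      by (simp add: zero_ereal_def)
    then have "X t * deriv Y t = Y t * deriv X t" for t
      by (simp add: sup_norm_le_iff heis_f_def)
    then have "on_line_through_origin X Y J"
      by (rule zero_areal_velocity_imp_line[OF C1X C1Y _ J pol])
    then show ?thesis ..
  qed simp
qed

end
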